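(* Let $S\subseteq R$ be an $m$-system of a ring $R$ with identity, let $P$ be an ideal of $R$ such that $P\cap S=\emptyset$, and let $s\in S$. Then the following statements are equivalent. (1) $P$ is an almost right $S$-prime ideal associated with $s$. (2) For all $r\in R\setminus(P:\langle s\rangle)$, either $(P:\langle r\rangle)\subseteq(P:\langle s\rangle)$ or $(P:\langle r\rangle)=(P^2:\langle r\rangle)$.
   Context: Rings are associative and not necessarily commutative; ideals are two-sided. An $m$-system of $R$ is a nonempty subset $S\subseteq R$ such that for all $a,b\in S$ there is $r\in R$ with $arb\in S$. $\langle x\rangle$ denotes the two-sided ideal generated by $x$. For ideals $A,B$, $AB$ is the additive subgroup generated by products $ab$ ($a\in A,b\in B$), and $P^2=PP$. For ideals $P,J$ of $R$, $(P:J)=\{x\in R: xJ\subseteq P\}$. An ideal $P$ with $P\cap S=\emptyset$ is an almost right $S$-prime ideal associated with $s\in S$ if for all ideals $A,B$ of $R$ with $AB\subseteq P$ and $AB\not\subseteq P^2$, either $A\langle s\rangle\subseteq P$ or $B\langle s\rangle\subseteq P$. *)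

theory Defs
  imports "HOL-Algebra.Ideal_Product"
begin

definition m_system :: "('a, 'b) ring_scheme \<Rightarrow> 'a set \<Rightarrow> bool" where
  "m_system R S \<longleftrightarrow>
     S \<noteq> {} \<and> S \<subseteq> carrier R \<and>
     (\<forall>a\<in>S. \<forall>b\<in>S. \<exists>r\<in>carrier R. a \<otimes>\<^bsub>R\<^esub> r \<otimes>\<^bsub>R\<^esub> b \<in> S)"

(* The colon set (P : J) = {x. x J \<subseteq> P}; the multiplier x is on the left. *)
definition ideal_colon :: "('a, 'b) ring_scheme \<Rightarrow> 'a set \<Rightarrow> 'a set \<Rightarrow> 'a set" where
  "ideal_colon R P J = {x \<in> carrier R. \<forall>y\<in>J. x \<otimes>\<^bsub>R\<^esub> y \<in> P}"

(* For ideals A and B, "A \<cdot>\<^bsub>R\<^esub> B" is closed under negation because A is, so the library's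
   closure of the products under addition is the additive subgroup they generate. *)
definition almost_right_S_prime ::
  "('a, 'b) ring_scheme \<Rightarrow> 'a set \<Rightarrow> 'a set \<Rightarrow> 'a \<Rightarrow> bool" where
  "almost_right_S_prime R S P s \<longleftrightarrow>
     ideal P R \<and> P \<inter> S = {} \<and> s \<in> S \<and>
     (\<forall>A B. ideal A R \<longrightarrow> ideal B R \<longrightarrow>
        A \<cdot>\<^bsub>R\<^esub> B \<subseteq> P \<longrightarrow> \<not> A \<cdot>\<^bsub>R\<^esub> B \<subseteq> P \<cdot>\<^bsub>R\<^esub> P \<longrightarrow>
        A \<cdot>\<^bsub>R\<^esub> (Idl\<^bsub>R\<^esub> {s}) \<subseteq> P \<or> B \<cdot>\<^bsub>R\<^esub> (Idl\<^bsub>R\<^esub> {s}) \<subseteq> P)"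

end

theory Submission
  imports Defs
begin

text \<open>
  Both conditions are statements about colon ideals, because \<open>A \<cdot> B \<subseteq> Q\<close> says the same as
  \<open>A \<subseteq> (Q : B)\<close>. Write \<open>C = (P : \<langle>s\<rangle>)\<close>.

  If \<open>P\<close> is almost right \<open>S\<close>-prime and \<open>r \<notin> C\<close>, the defining property applied to the pair of ideals
  \<open>(P : \<langle>r\<rangle>)\<close> and \<open>\<langle>r\<rangle>\<close> gives the second condition: either their product lies in \<open>P\<^sup>2\<close>, and then
  \<open>(P : \<langle>r\<rangle>) = (P\<^sup>2 : \<langle>r\<rangle>)\<close>, or one of the two lies in \<open>C\<close>, which has to be the first.

  Conversely, let \<open>A \<cdot> B \<subseteq> P\<close> with neither \<open>A\<close> nor \<open>B\<close> inside \<open>C\<close>. For \<open>r \<in> B - C\<close> the ideal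
  \<open>(P : \<langle>r\<rangle>)\<close> contains \<open>A\<close>, so it is not inside \<open>C\<close>; it therefore equals \<open>(P\<^sup>2 : \<langle>r\<rangle>)\<close>, and
  \<open>A r \<subseteq> P\<^sup>2\<close>. The remaining elements of \<open>B\<close> are reached by translation: as \<open>B\<close> is not inside \<open>C\<close>,
  every element of \<open>B \<inter> C\<close> is a difference of two elements of \<open>B - C\<close>. Hence \<open>A \<cdot> B \<subseteq> P\<^sup>2\<close>.
\<close>

context ring
begin

lemma ideal_prod_subset_iff_colon:
  assumes "additive_subgroup Q R" and "A \<subseteq> carrier R"
  shows "A \<cdot> B \<subseteq> Q \<longleftrightarrow> A \<subseteq> ideal_colon R Q B"
proof
  assume "A \<cdot> B \<subseteq> Q"
  then show "A \<subseteq> ideal_colon R Q B"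
    using assms(2) by (auto simp: ideal_colon_def intro: ideal_prod.prod)
next
  assume colon: "A \<subseteq> ideal_colon R Q B"
  show "A \<cdot> B \<subseteq> Q"
  proof
    fix x assume "x \<in> A \<cdot> B"
    then show "x \<in> Q"
    proof induction
      case (prod a b)
      then show ?case using colon by (auto simp: ideal_colon_def)
    next
      case (sum x y)
      then show ?case using additive_subgroup.a_closed[OF assms(1)] by blast
    qed
  qed
qed

text \<open>
  Left multiples stay in the colon because \<open>Q\<close> absorbs them; right multiples stay because \<open>J\<close> does:
  \<open>(x r) y = x (r y)\<close> with \<open>r y \<in> J\<close>.
\<close>

lemma ideal_ideal_colon:
  assumes "ideal Q R" and "ideal J R"
  shows "ideal (ideal_colon R Q J) R"
proof (rule idealI)
  interpret Q: ideal Q R by fact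
  interpret J: ideal J R by fact
  show "ring R" by (rule ring_axioms)
  show "subgroup (ideal_colon R Q J) (add_monoid R)"
  proof
    show "ideal_colon R Q J \<subseteq> carrier (add_monoid R)"
      by (auto simp: ideal_colon_def)
    show "x \<otimes>\<^bsub>add_monoid R\<^esub> y \<in> ideal_colon R Q J"
      if "x \<in> ideal_colon R Q J" "y \<in> ideal_colon R Q J" for x y
      using that by (auto simp: ideal_colon_def l_distr J.a_Hcarr)
    show "\<one>\<^bsub>add_monoid R\<^esub> \<in> ideal_colon R Q J"
      by (auto simp: ideal_colon_def J.a_Hcarr)
    show "inv\<^bsub>add_monoid R\<^esub> x \<in> ideal_colon R Q J"
      if "x \<in> ideal_colon R Q J" for x
      using that by (auto simp: ideal_colon_def l_minus J.a_Hcarr simp flip: a_inv_def)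
  qed
  show "r \<otimes> x \<in> ideal_colon R Q J" if "x \<in> ideal_colon R Q J" "r \<in> carrier R" for x r
    using that by (auto simp: ideal_colon_def m_assoc J.a_Hcarr Q.I_l_closed)
  show "x \<otimes> r \<in> ideal_colon R Q J" if "x \<in> ideal_colon R Q J" "r \<in> carrier R" for x r
    using that by (auto simp: ideal_colon_def m_assoc J.a_Hcarr J.I_l_closed)
qed

text \<open>
  If \<open>b \<in> B\<close> lies in \<open>C\<close> and \<open>b\<^sub>0 \<in> B\<close> does not, then \<open>b + b\<^sub>0\<close> lies in \<open>B\<close> outside \<open>C\<close>, and
  \<open>x b = x (b + b\<^sub>0) - x b\<^sub>0\<close>. This is how a subgroup is controlled by the complement of
  another one that does not contain it.
\<close>

lemma colon_of_diff_subgroup: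
  assumes "additive_subgroup Q R" and "additive_subgroup B R" and "additive_subgroup C R"
    and "\<not> B \<subseteq> C" and x: "x \<in> ideal_colon R Q (B - C)"
  shows "x \<in> ideal_colon R Q B"
proof -
  interpret Q: additive_subgroup Q R by fact
  interpret B: additive_subgroup B R by fact
  interpret C: additive_subgroup C R by fact
  obtain b\<^sub>0 where b0: "b\<^sub>0 \<in> B" "b\<^sub>0 \<notin> C" using \<open>\<not> B \<subseteq> C\<close> by blast
  have xR: "x \<in> carrier R" and xQ: "\<And>b. b \<in> B \<Longrightarrow> b \<notin> C \<Longrightarrow> x \<otimes> b \<in> Q"
    using x by (auto simp: ideal_colon_def)
  have "x \<otimes> b \<in> Q" if b: "b \<in> B" for b
  proof (cases "b \<in> C")
    case True
    have carr: "b \<in> carrier R" "b\<^sub>0 \<in> carrier R" using b b0 B.a_Hcarr by auto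
    have "b \<oplus> b\<^sub>0 \<notin> C"
    proof
      assume "b \<oplus> b\<^sub>0 \<in> C"
      then have "\<ominus> b \<oplus> (b \<oplus> b\<^sub>0) \<in> C" using True by simp
      then show False using carr b0 by (simp add: r_neg1)
    qed
    then have "x \<otimes> (b \<oplus> b\<^sub>0) \<oplus> \<ominus> (x \<otimes> b\<^sub>0) \<in> Q"
      using xQ b b0 by simp
    moreover have "x \<otimes> (b \<oplus> b\<^sub>0) \<oplus> \<ominus> (x \<otimes> b\<^sub>0) = x \<otimes> b"
      using xR carr by (simp add: r_distr a_assoc r_neg)
    ultimately show ?thesis by simp
  qed (use xQ b in blast)
  with xR show ?thesis by (auto simp: ideal_colon_def)
qed

end

theorem theorem3p10:
  fixes R :: "('a, 'b) ring_scheme" and S P :: "'a set" and s :: 'a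
  assumes "ring R"
    and "m_system R S"
    and "ideal P R"
    and "P \<inter> S = {}"
    and "s \<in> S"
  shows "almost_right_S_prime R S P s \<longleftrightarrow>
    (\<forall>r \<in> carrier R - ideal_colon R P (Idl\<^bsub>R\<^esub> {s}).
       ideal_colon R P (Idl\<^bsub>R\<^esub> {r}) \<subseteq> ideal_colon R P (Idl\<^bsub>R\<^esub> {s}) \<or>
       ideal_colon R P (Idl\<^bsub>R\<^esub> {r}) = ideal_colon R (P \<cdot>\<^bsub>R\<^esub> P) (Idl\<^bsub>R\<^esub> {r}))"
proof -
  interpret ring R by fact
  define C where "C = ideal_colon R P (Idl\<^bsub>R\<^esub> {s})"
  have "s \<in> carrier R" using assms(2,5) by (auto simp: m_system_def)
  then have ideal_C: "ideal C R"
    unfolding C_def by (intro ideal_ideal_colon assms genideal_ideal) simp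
  have ideal_PP: "ideal (P \<cdot>\<^bsub>R\<^esub> P) R" by (intro ideal_prod_is_ideal assms)
  have PP_subset: "P \<cdot>\<^bsub>R\<^esub> P \<subseteq> P" using ideal_prod_inter[OF assms(3,3)] by simp
  have subset_P: "A \<cdot>\<^bsub>R\<^esub> B \<subseteq> P \<longleftrightarrow> A \<subseteq> ideal_colon R P B"
    and subset_PP: "A \<cdot>\<^bsub>R\<^esub> B \<subseteq> P \<cdot>\<^bsub>R\<^esub> P \<longleftrightarrow> A \<subseteq> ideal_colon R (P \<cdot>\<^bsub>R\<^esub> P) B"
    if "ideal A R" for A B
  proof -
    have A: "A \<subseteq> carrier R" using ideal.Icarr[OF that] by blast
    show "A \<cdot>\<^bsub>R\<^esub> B \<subseteq> P \<longleftrightarrow> A \<subseteq> ideal_colon R P B"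
      by (rule ideal_prod_subset_iff_colon[OF ideal.axioms(1)[OF assms(3)] A])
    show "A \<cdot>\<^bsub>R\<^esub> B \<subseteq> P \<cdot>\<^bsub>R\<^esub> P \<longleftrightarrow> A \<subseteq> ideal_colon R (P \<cdot>\<^bsub>R\<^esub> P) B"
      by (rule ideal_prod_subset_iff_colon[OF ideal.axioms(1)[OF ideal_PP] A])
  qed
  have prime_iff: "almost_right_S_prime R S P s \<longleftrightarrow>
    (\<forall>A B. ideal A R \<longrightarrow> ideal B R \<longrightarrow> A \<subseteq> ideal_colon R P B \<longrightarrow>
       \<not> A \<subseteq> ideal_colon R (P \<cdot>\<^bsub>R\<^esub> P) B \<longrightarrow> A \<subseteq> C \<or> B \<subseteq> C)"
    using assms(3-5) subset_P subset_PP by (auto simp: almost_right_S_prime_def C_def)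
  show ?thesis
    unfolding C_def[symmetric]
  proof (intro iffI ballI)
    fix r
    assume prime: "almost_right_S_prime R S P s" and r: "r \<in> carrier R - C"
    have ideal_r: "ideal (Idl\<^bsub>R\<^esub> {r}) R" using r by (intro genideal_ideal) auto
    have "\<not> Idl\<^bsub>R\<^esub> {r} \<subseteq> C" using r genideal_self'[of r] by blast
    then have "ideal_colon R P (Idl\<^bsub>R\<^esub> {r}) \<subseteq> C \<or>
        ideal_colon R P (Idl\<^bsub>R\<^esub> {r}) \<subseteq> ideal_colon R (P \<cdot>\<^bsub>R\<^esub> P) (Idl\<^bsub>R\<^esub> {r})"
      using prime ideal_ideal_colon[OF assms(3) ideal_r] ideal_r unfolding prime_iff by blast
    moreover have "ideal_colon R (P \<cdot>\<^bsub>R\<^esub> P) (Idl\<^bsub>R\<^esub> {r}) \<subseteq> ideal_colon R P (Idl\<^bsub>R\<^esub> {r})"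
      using PP_subset by (auto simp: ideal_colon_def)
    ultimately show "ideal_colon R P (Idl\<^bsub>R\<^esub> {r}) \<subseteq> C \<or>
        ideal_colon R P (Idl\<^bsub>R\<^esub> {r}) = ideal_colon R (P \<cdot>\<^bsub>R\<^esub> P) (Idl\<^bsub>R\<^esub> {r})" by blast
  next
    assume colons: "\<forall>r \<in> carrier R - C. ideal_colon R P (Idl\<^bsub>R\<^esub> {r}) \<subseteq> C \<or>
        ideal_colon R P (Idl\<^bsub>R\<^esub> {r}) = ideal_colon R (P \<cdot>\<^bsub>R\<^esub> P) (Idl\<^bsub>R\<^esub> {r})"
    have "A \<subseteq> ideal_colon R (P \<cdot>\<^bsub>R\<^esub> P) B"
      if A: "ideal A R" and B: "ideal B R" and AB: "A \<subseteq> ideal_colon R P B"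
        and nA: "\<not> A \<subseteq> C" and nB: "\<not> B \<subseteq> C" for A B
    proof
      fix a assume a: "a \<in> A"
      have "a \<otimes>\<^bsub>R\<^esub> r \<in> P \<cdot>\<^bsub>R\<^esub> P" if r: "r \<in> B - C" for r
      proof -
        have rR: "r \<in> carrier R" using r ideal.Icarr[OF B] by blast
        have "Idl\<^bsub>R\<^esub> {r} \<subseteq> B" using r by (intro genideal_minimal B) auto
        then have A_colon: "A \<subseteq> ideal_colon R P (Idl\<^bsub>R\<^esub> {r})"
          using AB by (auto simp: ideal_colon_def)
        then have "ideal_colon R P (Idl\<^bsub>R\<^esub> {r}) = ideal_colon R (P \<cdot>\<^bsub>R\<^esub> P) (Idl\<^bsub>R\<^esub> {r})"
          using colons nA r rR by blast
        then have "a \<in> ideal_colon R (P \<cdot>\<^bsub>R\<^esub> P) (Idl\<^bsub>R\<^esub> {r})" using A_colon a by blast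
        then show ?thesis using genideal_self'[OF rR] by (auto simp: ideal_colon_def)
      qed
      then have "a \<in> ideal_colon R (P \<cdot>\<^bsub>R\<^esub> P) (B - C)"
        using a ideal.Icarr[OF A] by (auto simp: ideal_colon_def)
      then show "a \<in> ideal_colon R (P \<cdot>\<^bsub>R\<^esub> P) B"
        by (rule colon_of_diff_subgroup[OF ideal.axioms(1)[OF ideal_PP]
              ideal.axioms(1)[OF B] ideal.axioms(1)[OF ideal_C] nB])
    qed
    then show "almost_right_S_prime R S P s" unfolding prime_iff by blast
  qed
qed

end
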